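(* Let $\lambda, c\in\mathbb{R}$ with $0<|c|<\lambda$, and consider the real scalar coupled system $$u''+u'+\lambda u+cv=0,\qquad v''+\lambda v+cu=0. \qquad (S)$$ Let $\mathcal{E}(u,u',v,v')=\frac12\left[u'^2+v'^2+\lambda(u^2+v^2)\right]+cuv$. Then for every fixed $p>1$ there exists $\varepsilon_0>0$ such that for all $\varepsilon\in(0,\varepsilon_0)$ the quadratic form $$H_\varepsilon=\mathcal{E}-\varepsilon vv'+p\varepsilon uu'+\frac{(p+1)\lambda\varepsilon}{2c}(u'v-uv')$$ in the variables $(u,u',v,v')\in\mathbb{R}^4$ is a strict Liapunov function for $(S)$.
   Context: A quadratic form $Q$ on $\mathbb{R}^4$ is called a strict Liapunov function for $(S)$ if it is positive definite and there is a constant $\delta>0$ such that $\frac{d}{dt}Q(u(t),u'(t),v(t),v'(t))\le-\delta\,Q(u(t),u'(t),v(t),v'(t))$ for every $t\ge 0$ and every real solution $(u,v)$ of $(S)$. *)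

theory Defs
  imports "HOL-Analysis.Analysis"
begin

definition quadratic_form :: "('a::real_vector \<Rightarrow> real) \<Rightarrow> bool" where
  "quadratic_form Q \<longleftrightarrow> (\<exists>B. bilinear B \<and> (\<forall>x y. B x y = B y x) \<and> (\<forall>x. Q x = B x x))"

definition positive_definite :: "('a::real_vector \<Rightarrow> real) \<Rightarrow> bool" where
  "positive_definite Q \<longleftrightarrow> (\<forall>x. x \<noteq> 0 \<longrightarrow> Q x > 0)"

(* Solutions live on the half-line [0, \<infinity>), with one-sided derivatives at 0.
   The functions u' and v' are the first derivatives of u and v. *)
definition solution_S ::
  "real \<Rightarrow> real \<Rightarrow> (real \<Rightarrow> real) \<Rightarrow> (real \<Rightarrow> real) \<Rightarrow> (real \<Rightarrow> real) \<Rightarrow> (real \<Rightarrow> real) \<Rightarrow> bool" where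
  "solution_S lam c u u' v v' \<longleftrightarrow>
     (\<exists>u'' v''. \<forall>t\<ge>0.
        (u has_real_derivative u' t) (at t within {0..}) \<and>
        (u' has_real_derivative u'' t) (at t within {0..}) \<and>
        (v has_real_derivative v' t) (at t within {0..}) \<and>
        (v' has_real_derivative v'' t) (at t within {0..}) \<and>
        u'' t + u' t + lam * u t + c * v t = 0 \<and>
        v'' t + lam * v t + c * u t = 0)"

lemma vector_4 [simp]:
  "(vector [w, x, y, z] :: 'a::zero ^ 4) $ 1 = w"
  "(vector [w, x, y, z] :: 'a::zero ^ 4) $ 2 = x"
  "(vector [w, x, y, z] :: 'a::zero ^ 4) $ 3 = y"
  "(vector [w, x, y, z] :: 'a::zero ^ 4) $ 4 = z"
  unfolding vector_def by simp_all

definition strict_liapunov_S :: "real \<Rightarrow> real \<Rightarrow> (real ^ 4 \<Rightarrow> real) \<Rightarrow> bool" where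
  "strict_liapunov_S lam c Q \<longleftrightarrow>
     quadratic_form Q \<and> positive_definite Q \<and>
     (\<exists>\<delta>>0. \<forall>u u' v v'. solution_S lam c u u' v v' \<longrightarrow>
        (\<forall>t\<ge>0. \<exists>D. ((\<lambda>s. Q (vector [u s, u' s, v s, v' s])) has_real_derivative D)
                      (at t within {0..}) \<and>
                    D \<le> - \<delta> * Q (vector [u t, u' t, v t, v' t])))"

(* The coordinates of the argument are ordered as (u, u', v, v'). *)
definition energy :: "real \<Rightarrow> real \<Rightarrow> real ^ 4 \<Rightarrow> real" where
  "energy lam c x =
     (let u = x $ 1; u' = x $ 2; v = x $ 3; v' = x $ 4
      in 1 / 2 * (u'\<^sup>2 + v'\<^sup>2 + lam * (u\<^sup>2 + v\<^sup>2)) + c * u * v)"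

definition H_form :: "real \<Rightarrow> real \<Rightarrow> real \<Rightarrow> real \<Rightarrow> real ^ 4 \<Rightarrow> real" where
  "H_form lam c p \<epsilon> x =
     (let u = x $ 1; u' = x $ 2; v = x $ 3; v' = x $ 4
      in energy lam c x - \<epsilon> * v * v' + p * \<epsilon> * u * u'
         + (p + 1) * lam * \<epsilon> / (2 * c) * (u' * v - u * v'))"

end

theory Submission
  imports Defs
begin

text \<open>
  Put k = (p + 1) lam / (2 c). Along solutions the quantity u'v - uv' differentiates, up to the
  damping term, to c (u^2 - v^2). The factor k is chosen so that this turns the indefinite part
  lam (v^2 - p u^2) of the remaining terms into -(p - 1)/2 lam (u^2 + v^2), and together with the
  terms in uv one gets -(p - 1)/2 times the potential form lam (u^2 + v^2) + 2 c u v, which is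
  definite because |c| < lam. The cross terms u u' and u' v are of order \<epsilon> and are absorbed, by
  Young's inequality, into this form and the damping -u'^2.
\<close>

lemma abs_mult_le_young:
  fixes x y q :: real
  assumes "q > 0"
  shows "\<bar>x * y\<bar> \<le> q / 2 * x\<^sup>2 + y\<^sup>2 / (2 * q)"
proof -
  have "0 \<le> (q * \<bar>x\<bar> - \<bar>y\<bar>)\<^sup>2 / (2 * q)"
    using assms by simp
  also have "\<dots> = q / 2 * x\<^sup>2 + y\<^sup>2 / (2 * q) - \<bar>x * y\<bar>"
    using assms by (simp add: power2_diff power_mult_distrib abs_mult field_simps power2_eq_square)
  finally show ?thesis by simp
qed

text \<open>The symmetric matrix of this form has eigenvalues \<open>lam + c\<close> and
  \<open>lam - c\<close>, the smaller being \<open>lam - \<bar>c\<bar>\<close>. The bound drives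
  both positive definiteness and dissipation.\<close>

lemma potential_lower_bound:
  fixes lam c u v :: real
  shows "(lam - \<bar>c\<bar>) * (u\<^sup>2 + v\<^sup>2) \<le> lam * (u\<^sup>2 + v\<^sup>2) + 2 * c * u * v"
proof -
  have "\<bar>c\<bar> * (2 * \<bar>u * v\<bar>) \<le> \<bar>c\<bar> * (u\<^sup>2 + v\<^sup>2)"
    using abs_mult_le_young[of 1 u v] by (intro mult_left_mono) auto
  moreover have "- (2 * c * u * v) \<le> \<bar>c\<bar> * (2 * \<bar>u * v\<bar>)"
    using abs_ge_minus_self[of "2 * c * u * v"] by (simp add: abs_mult mult_ac)
  ultimately show ?thesis by (simp add: algebra_simps)
qed

lemma quadratic_form_H_form: "quadratic_form (H_form lam c p \<epsilon>)"
proof -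
  define k where "k = (p + 1) * lam * \<epsilon> / (2 * c)"
  \<comment> \<open>Polarization: each mixed product of the form is split evenly into two symmetric
    halves.\<close>
  define B :: "real ^ 4 \<Rightarrow> real ^ 4 \<Rightarrow> real" where
    "B x y = 1 / 2 * (x$2 * y$2 + x$4 * y$4 + lam * (x$1 * y$1 + x$3 * y$3))
       + c / 2 * (x$1 * y$3 + x$3 * y$1) - \<epsilon> / 2 * (x$3 * y$4 + x$4 * y$3)
       + p * \<epsilon> / 2 * (x$1 * y$2 + x$2 * y$1)
       + k / 2 * (x$2 * y$3 + x$3 * y$2 - x$1 * y$4 - x$4 * y$1)" for x y
  have "bilinear B"
    unfolding bilinear_def B_def
    by (auto intro!: linearI simp: algebra_simps add_divide_distrib diff_divide_distrib)
  moreover have "B x y = B y x" for x y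
    unfolding B_def by (simp add: algebra_simps)
  moreover have "H_form lam c p \<epsilon> x = B x x" for x
    unfolding H_form_def energy_def B_def Let_def k_def[symmetric]
    by (simp add: power2_eq_square algebra_simps)
  ultimately show ?thesis
    unfolding quadratic_form_def by blast
qed

text \<open>Each of the three added products is bounded by the squared norm, so the correction is of
  order \<epsilon> and bounds on the energy carry over to \<open>H_form\<close> for small
  \<epsilon>.\<close>

lemma H_form_energy_diff:
  assumes "\<epsilon> \<ge> 0" "p \<ge> 0"
  shows "\<bar>H_form lam c p \<epsilon> x - energy lam c x\<bar>
    \<le> \<epsilon> * (1 + p + \<bar>(p + 1) * lam / (2 * c)\<bar>) * ((x$1)\<^sup>2 + (x$2)\<^sup>2 + (x$3)\<^sup>2 + (x$4)\<^sup>2)"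
proof -
  define k where "k = (p + 1) * lam / (2 * c)"
  define N where "N = (x$1)\<^sup>2 + (x$2)\<^sup>2 + (x$3)\<^sup>2 + (x$4)\<^sup>2"
  note young = abs_mult_le_young[of 1, simplified]
  have "\<bar>x$3 * x$4\<bar> \<le> N" "\<bar>x$1 * x$2\<bar> \<le> N" "\<bar>x$2 * x$3 - x$1 * x$4\<bar> \<le> N"
    using young[of "x$3" "x$4"] young[of "x$1" "x$2"] young[of "x$2" "x$3"] young[of "x$1" "x$4"]
      zero_le_power2[of "x$1"] zero_le_power2[of "x$2"] zero_le_power2[of "x$3"]
      zero_le_power2[of "x$4"] unfolding N_def by linarith+
  then have "\<bar>\<epsilon> * (x$3 * x$4)\<bar> \<le> \<epsilon> * N" "\<bar>p * \<epsilon> * (x$1 * x$2)\<bar> \<le> p * \<epsilon> * N"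
    "\<bar>\<epsilon> * k * (x$2 * x$3 - x$1 * x$4)\<bar> \<le> \<epsilon> * \<bar>k\<bar> * N"
    using assms by (simp_all add: abs_mult[of _ "x$3 * x$4"] abs_mult[of _ "x$1 * x$2"]
      abs_mult[of _ "x$2 * x$3 - x$1 * x$4"] abs_mult[of _ k] abs_mult[of _ \<epsilon>] mult_left_mono)
  moreover have "H_form lam c p \<epsilon> x - energy lam c x
      = - (\<epsilon> * (x$3 * x$4)) + p * \<epsilon> * (x$1 * x$2) + \<epsilon> * k * (x$2 * x$3 - x$1 * x$4)"
    unfolding H_form_def Let_def k_def by (simp add: mult_ac)
  ultimately have "\<bar>H_form lam c p \<epsilon> x - energy lam c x\<bar> \<le> \<epsilon> * N + p * \<epsilon> * N + \<epsilon> * \<bar>k\<bar> * N"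
    by linarith
  then show ?thesis
    unfolding N_def[symmetric] k_def[symmetric] by (simp add: algebra_simps)
qed

text \<open>The energy splits into a kinetic part with coefficient 1/2 and a potential part with
  smallest eigenvalue \<open>(lam - \<bar>c\<bar>) / 2\<close>; \<mu> lies below both.\<close>

lemma energy_lower_bound:
  assumes "\<mu> \<le> 1 / 2" "\<mu> \<le> (lam - \<bar>c\<bar>) / 2"
  shows "\<mu> * ((x$1)\<^sup>2 + (x$2)\<^sup>2 + (x$3)\<^sup>2 + (x$4)\<^sup>2) \<le> energy lam c x"
proof -
  have "\<mu> * ((x$2)\<^sup>2 + (x$4)\<^sup>2) \<le> 1 / 2 * ((x$2)\<^sup>2 + (x$4)\<^sup>2)"
    "\<mu> * ((x$1)\<^sup>2 + (x$3)\<^sup>2) \<le> (lam - \<bar>c\<bar>) / 2 * ((x$1)\<^sup>2 + (x$3)\<^sup>2)"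
    using assms by (intro mult_right_mono; simp)+
  moreover have "(lam - \<bar>c\<bar>) / 2 * ((x$1)\<^sup>2 + (x$3)\<^sup>2)
      \<le> lam / 2 * ((x$1)\<^sup>2 + (x$3)\<^sup>2) + c * x$1 * x$3"
    using potential_lower_bound[of lam c "x$1" "x$3"] by simp
  ultimately show ?thesis
    unfolding energy_def Let_def by (simp add: algebra_simps)
qed

lemma energy_upper_bound:
  assumes "\<bar>c\<bar> \<le> lam"
  shows "energy lam c x \<le> (1 / 2 + lam) * ((x$1)\<^sup>2 + (x$2)\<^sup>2 + (x$3)\<^sup>2 + (x$4)\<^sup>2)"
proof -
  have "\<bar>c\<bar> * ((x$1)\<^sup>2 + (x$3)\<^sup>2) \<le> lam * ((x$1)\<^sup>2 + (x$3)\<^sup>2)"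
    using assms by (intro mult_right_mono) auto
  \<comment> \<open>With 0 for \<open>lam\<close> and \<open>- c\<close> for \<open>c\<close>, the
    lower bound becomes an upper bound on the coupling term.\<close>
  moreover have "2 * (c * x$1 * x$3) \<le> \<bar>c\<bar> * ((x$1)\<^sup>2 + (x$3)\<^sup>2)"
    using potential_lower_bound[of 0 "- c" "x$1" "x$3"] by simp
  ultimately have "c * x$1 * x$3 \<le> lam / 2 * ((x$1)\<^sup>2 + (x$3)\<^sup>2)"
    by linarith
  moreover have "0 \<le> ((x$1)\<^sup>2 + (x$3)\<^sup>2) / 2 + lam * ((x$2)\<^sup>2 + (x$4)\<^sup>2)"
    using assms by (intro add_nonneg_nonneg mult_nonneg_nonneg) auto
  ultimately show ?thesis
    unfolding energy_def Let_def by (simp add: algebra_simps add_divide_distrib)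
qed

lemma H_form_has_derivative:
  fixes lam c p \<epsilon> :: real
  assumes "solution_S lam c u u' v v'" and "t \<ge> 0" and "c \<noteq> 0"
  shows "((\<lambda>s. H_form lam c p \<epsilon> (vector [u s, u' s, v s, v' s])) has_real_derivative
     - (1 - p * \<epsilon>) * (u' t)\<^sup>2 - \<epsilon> * (v' t)\<^sup>2
     - \<epsilon> * (p - 1) / 2 * (lam * ((u t)\<^sup>2 + (v t)\<^sup>2) + 2 * c * u t * v t)
     - \<epsilon> * p * (u t * u' t) - \<epsilon> * ((p + 1) * lam / (2 * c)) * (v t * u' t)) (at t within {0..})"
proof -
  \<comment> \<open>Here \<open>k\<close> includes the factor \<epsilon>; it is split off again at
    the end.\<close>
  define k where "k = (p + 1) * lam * \<epsilon> / (2 * c)"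
  have kc: "k * c = (p + 1) * lam * \<epsilon> / 2"
    using assms(3) by (simp add: k_def)
  obtain u'' v'' where
    d: "(u has_real_derivative u' t) (at t within {0..})"
       "(u' has_real_derivative u'' t) (at t within {0..})"
       "(v has_real_derivative v' t) (at t within {0..})"
       "(v' has_real_derivative v'' t) (at t within {0..})"
    and eq: "u'' t + u' t + lam * u t + c * v t = 0" "v'' t + lam * v t + c * u t = 0"
    using assms(1,2) unfolding solution_S_def by blast
  have u'': "u'' t = - u' t - lam * u t - c * v t" and v'': "v'' t = - lam * v t - c * u t"
    using eq by linarith+
  have "((\<lambda>s. H_form lam c p \<epsilon> (vector [u s, u' s, v s, v' s])) has_real_derivative
      u' t * u'' t + v' t * v'' t + lam * (u t * u' t + v t * v' t) + c * (u' t * v t + u t * v' t)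
      - \<epsilon> * (v' t * v' t + v t * v'' t) + p * \<epsilon> * (u' t * u' t + u t * u'' t)
      + k * (u'' t * v t - u t * v'' t)) (at t within {0..})"
    unfolding H_form_def energy_def Let_def vector_4 k_def[symmetric]
    by (rule derivative_eq_intros d refl)+ (simp add: algebra_simps)
  also have "u' t * u'' t + v' t * v'' t + lam * (u t * u' t + v t * v' t)
      + c * (u' t * v t + u t * v' t)
      - \<epsilon> * (v' t * v' t + v t * v'' t) + p * \<epsilon> * (u' t * u' t + u t * u'' t)
      + k * (u'' t * v t - u t * v'' t)
    = - (1 - p * \<epsilon>) * (u' t)\<^sup>2 - \<epsilon> * (v' t)\<^sup>2 + \<epsilon> * lam * (v t)\<^sup>2 + (1 - p) * \<epsilon> * c * u t * v t
      - p * \<epsilon> * lam * (u t)\<^sup>2 - \<epsilon> * p * (u t * u' t)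
      + (k * c) * ((u t)\<^sup>2 - (v t)\<^sup>2) - k * (v t * u' t)"
    unfolding u'' v'' by (simp add: algebra_simps power2_eq_square)
  \<comment> \<open>By \<open>kc\<close>, the coefficients of u^2 and v^2, divided by
    \<open>\<epsilon> * lam\<close>, are -p + (p + 1)/2 and 1 - (p + 1)/2: both equal -(p -
    1)/2.\<close>
  also have "\<dots> = - (1 - p * \<epsilon>) * (u' t)\<^sup>2 - \<epsilon> * (v' t)\<^sup>2
      - \<epsilon> * (p - 1) / 2 * (lam * ((u t)\<^sup>2 + (v t)\<^sup>2) + 2 * c * u t * v t)
      - \<epsilon> * p * (u t * u' t) - k * (v t * u' t)"
    unfolding kc by (simp add: field_simps)
  also have "k = \<epsilon> * ((p + 1) * lam / (2 * c))"
    by (simp add: k_def)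
  finally show ?thesis .
qed

text \<open>A budget: the potential form supplies \<epsilon>q(u^2 + v^2), and the two cross terms
  use half of it. Their remainders in a^2, together with p\<epsilon>a^2, use at most half of the
  damping by \<open>small\<close>. What is left dominates \<open>d\<close> times the squared
  norm.\<close>

lemma dissipation_bound:
  fixes lam c p \<epsilon> k q u a v b :: real
  assumes "p > 1" "\<epsilon> > 0" "q > 0" and q: "q = (p - 1) / 2 * (lam - \<bar>c\<bar>)"
    and small: "\<epsilon> * (p + (p\<^sup>2 + k\<^sup>2) / (2 * q)) \<le> 1 / 2"
    and d: "d \<le> 1 / 2" "d \<le> \<epsilon>" "d \<le> \<epsilon> * q / 2"
  shows "- (1 - p * \<epsilon>) * a\<^sup>2 - \<epsilon> * b\<^sup>2 - \<epsilon> * (p - 1) / 2 * (lam * (u\<^sup>2 + v\<^sup>2) + 2 * c * u * v)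
     - \<epsilon> * p * (u * a) - \<epsilon> * k * (v * a) \<le> - d * (u\<^sup>2 + a\<^sup>2 + v\<^sup>2 + b\<^sup>2)"
proof -
  \<comment> \<open>The factor \<open>r\<close> is grouped with \<open>a\<close>, so the share of
    w^2 is the same for r = p and r = k.\<close>
  have cross: "- (\<epsilon> * r * (w * a)) \<le> \<epsilon> * (q / 2 * w\<^sup>2 + r\<^sup>2 / (2 * q) * a\<^sup>2)" for r w
  proof -
    have "- (w * (r * a)) \<le> q / 2 * w\<^sup>2 + (r * a)\<^sup>2 / (2 * q)"
      using abs_mult_le_young[OF \<open>q > 0\<close>, of w "r * a"] by linarith
    from mult_left_mono[OF this, of \<epsilon>] show ?thesis
      using \<open>\<epsilon> > 0\<close> by (simp add: mult_ac power_mult_distrib)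
  qed
  have pot: "\<epsilon> * q * (u\<^sup>2 + v\<^sup>2)
      \<le> \<epsilon> * (p - 1) / 2 * (lam * (u\<^sup>2 + v\<^sup>2) + 2 * c * u * v)"
    using mult_left_mono[OF potential_lower_bound[of lam c u v], of "\<epsilon> * (p - 1) / 2"] assms(1,2)
    by (simp add: q mult_ac)
  have damp: "\<epsilon> * (p + (p\<^sup>2 + k\<^sup>2) / (2 * q)) * a\<^sup>2 \<le> 1 / 2 * a\<^sup>2"
    using small by (rule mult_right_mono) simp
  have "d * a\<^sup>2 \<le> 1 / 2 * a\<^sup>2" "d * b\<^sup>2 \<le> \<epsilon> * b\<^sup>2" "d * (u\<^sup>2 + v\<^sup>2) \<le> \<epsilon> * q / 2 * (u\<^sup>2 + v\<^sup>2)"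
    using d by (intro mult_right_mono; simp)+
  with cross[of p u] cross[of k v] pot damp show ?thesis
    by (simp add: algebra_simps add_divide_distrib)
qed

theorem proposition2p1:
  fixes lam c :: real
  assumes "0 < \<bar>c\<bar>" and "\<bar>c\<bar> < lam"
  shows "\<forall>p>1. \<exists>\<epsilon>0>0. \<forall>\<epsilon>\<in>{0<..<\<epsilon>0}. strict_liapunov_S lam c (H_form lam c p \<epsilon>)"
proof (intro allI impI)
  fix p :: real
  assume p: "p > 1"
  define k where "k = (p + 1) * lam / (2 * c)"
  define q where "q = (p - 1) / 2 * (lam - \<bar>c\<bar>)"
  define L where "L = 1 + p + \<bar>k\<bar>"
  define M where "M = p + (p\<^sup>2 + k\<^sup>2) / (2 * q)"
  define \<mu> where "\<mu> = min (1 / 2) ((lam - \<bar>c\<bar>) / 2)"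
  \<comment> \<open>The first entry keeps the correction below half of the energy's coercivity
    \<mu>; the second is the smallness required by \<open>dissipation_bound\<close>.\<close>
  define \<epsilon>0 where "\<epsilon>0 = min (\<mu> / (2 * L)) (1 / (2 * M))"
  have q: "q > 0" and L: "L > 0" and \<mu>: "\<mu> > 0"
    using assms p by (simp_all add: q_def L_def \<mu>_def)
  have M: "M > 0"
    using p q by (simp add: M_def add_pos_nonneg)
  have "strict_liapunov_S lam c (H_form lam c p \<epsilon>)" if "\<epsilon> \<in> {0<..<\<epsilon>0}" for \<epsilon>
  proof -
    define N :: "real ^ 4 \<Rightarrow> real" where "N x = (x$1)\<^sup>2 + (x$2)\<^sup>2 + (x$3)\<^sup>2 + (x$4)\<^sup>2" for x
    \<comment> \<open>\<open>C\<close> bounds the form from above and \<open>d\<close> is the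
      dissipation rate, both relative to \<open>N\<close>. Neither depends on the solution or on
      time, so \<open>d / C\<close> serves as the uniform decay constant.\<close>
    define C where "C = 1 / 2 + lam + \<epsilon> * L"
    define d where "d = min (1 / 2) (min \<epsilon> (\<epsilon> * q / 2))"
    have \<epsilon>: "\<epsilon> > 0" and \<epsilon>L: "\<epsilon> * L \<le> \<mu> / 2" and \<epsilon>M: "\<epsilon> * M \<le> 1 / 2"
      using that L M by (auto simp: \<epsilon>0_def field_simps)
    have d: "d > 0" and C: "C > 0"
      using \<epsilon> q L assms by (auto simp: d_def C_def intro!: add_pos_pos)
    have N0: "N x \<ge> 0" for x
      by (simp add: N_def)
    have diff: "\<bar>H_form lam c p \<epsilon> x - energy lam c x\<bar> \<le> \<epsilon> * L * N x" for x
      using H_form_energy_diff[of \<epsilon> p lam c x] \<epsilon> p by (simp add: L_def k_def N_def)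
    have lower: "\<mu> / 2 * N x \<le> H_form lam c p \<epsilon> x" for x
    proof -
      have "\<mu> * N x \<le> energy lam c x"
        unfolding N_def by (rule energy_lower_bound) (auto simp: \<mu>_def min_def)
      with diff[of x] mult_right_mono[OF \<epsilon>L N0[of x]] show ?thesis
        by simp
    qed
    have upper: "H_form lam c p \<epsilon> x \<le> C * N x" for x
      using energy_upper_bound[of c lam x, folded N_def] diff[of x] assms(2)
      by (simp add: C_def algebra_simps)
    have "positive_definite (H_form lam c p \<epsilon>)"
      unfolding positive_definite_def
    proof (intro allI impI)
      fix x :: "real ^ 4"
      assume "x \<noteq> 0"
      then have "N x \<noteq> 0"
        by (auto simp: N_def vec_eq_iff forall_4 add_nonneg_eq_0_iff)
      with N0[of x] \<mu> have "0 < \<mu> / 2 * N x"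
        by simp
      with lower[of x] show "0 < H_form lam c p \<epsilon> x"
        by linarith
    qed
    moreover have "\<exists>D. ((\<lambda>s. H_form lam c p \<epsilon> (vector [u s, u' s, v s, v' s]))
          has_real_derivative D) (at t within {0..})
        \<and> D \<le> - (d / C) * H_form lam c p \<epsilon> (vector [u t, u' t, v t, v' t])"
      if "solution_S lam c u u' v v'" "t \<ge> 0" for u u' v v' t
    proof (intro exI conjI)
      let ?x = "vector [u t, u' t, v t, v' t] :: real ^ 4"
      show "((\<lambda>s. H_form lam c p \<epsilon> (vector [u s, u' s, v s, v' s])) has_real_derivative
         - (1 - p * \<epsilon>) * (u' t)\<^sup>2 - \<epsilon> * (v' t)\<^sup>2
         - \<epsilon> * (p - 1) / 2 * (lam * ((u t)\<^sup>2 + (v t)\<^sup>2) + 2 * c * u t * v t)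
         - \<epsilon> * p * (u t * u' t) - \<epsilon> * k * (v t * u' t)) (at t within {0..})"
        (is "(_ has_real_derivative ?D) _")
        unfolding k_def using H_form_has_derivative[OF that] assms(1) by simp
      have "?D \<le> - d * ((u t)\<^sup>2 + (u' t)\<^sup>2 + (v t)\<^sup>2 + (v' t)\<^sup>2)"
        by (rule dissipation_bound[OF p \<epsilon> q q_def \<epsilon>M[unfolded M_def]]) (simp_all add: d_def)
      \<comment> \<open>Decay is so far measured by \<open>N\<close>; the upper bound
        \<open>C * N\<close> converts it into decay measured by the form itself.\<close>
      also have "\<dots> = - (d / C) * (C * N ?x)"
        using C by (simp add: N_def)
      also have "\<dots> \<le> - (d / C) * H_form lam c p \<epsilon> ?x"
        using d C by (intro mult_left_mono_neg upper) simp
      finally show "?D \<le> - (d / C) * H_form lam c p \<epsilon> ?x" .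
    qed
    ultimately show ?thesis
      unfolding strict_liapunov_S_def using quadratic_form_H_form d C
      by (meson divide_pos_pos)
  qed
  moreover have "\<epsilon>0 > 0"
    using L M \<mu> by (simp add: \<epsilon>0_def)
  ultimately show "\<exists>\<epsilon>0>0. \<forall>\<epsilon>\<in>{0<..<\<epsilon>0}. strict_liapunov_S lam c (H_form lam c p \<epsilon>)"
    by blast
qed

end
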